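(* Let $\mathsf{MVAlg}$ be the category of MV-algebras, $\mathsf{WHoops}$ the category of Wajsberg hoops, and $\mathbf{2}=\{0,1\}$ the two-element (initial) MV-algebra. The kernel functor \[ K\colon \mathsf{MVAlg}/\mathbf{2}\to\mathsf{WHoops}, \] defined on objects by letting, for an MV-homomorphism $f\colon A\to\mathbf{2}$, $K(f):=\mathrm{Ker}(f)$, is an equivalence of categories. Here $\mathrm{Ker}(f)$ is the kernel computed in $\mathsf{WHoops}$, i.e. the set $f^{-1}(1)$ with the Wajsberg hoop structure $(\odot,\to,1)$ inherited from $A$.
   Context: A hoop is an algebra $(A;\cdot,\to,1)$ such that $(A;\cdot,1)$ is a commutative monoid and the equations $x\to x=1$, $x\cdot(x\to y)=y\cdot(y\to x)$, $(x\cdot y)\to z=x\to(y\to z)$ hold. A Wajsberg hoop is a hoop satisfying $(x\to y)\to y=(y\to x)\to x$. $\mathsf{WHoops}$ has Wajsberg hoops as objects and homomorphisms of hoops as morphisms. An MV-algebra is an algebra $(A;\oplus,\neg,0)$ satisfying: $x\oplus(y\oplus z)=(x\oplus y)\oplus z$; $x\oplus y=y\oplus x$; $x\oplus 0=x$; $\neg\neg x=x$; $x\oplus\neg 0=\neg 0$; $\neg(\neg x\oplus y)\oplus y=\neg(\neg y\oplus x)\oplus x$. Derived operations: $1:=\neg 0$, $x\odot y:=\neg(\neg x\oplus\neg y)$, $x\to y:=\neg x\oplus y$. With these, $(A;\odot,\to,1)$ is a Wajsberg hoop, which gives the forgetful functor $U\colon\mathsf{MVAlg}\to\mathsf{WHoops}$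 (forgetting the constant $0$). $\mathsf{MVAlg}/\mathbf{2}$ is the slice category: objects are MV-homomorphisms $f\colon A\to\mathbf{2}$, and morphisms from $f$ to $f'\colon A'\to\mathbf{2}$ are MV-homomorphisms $\phi\colon A\to A'$ with $f'\circ\phi=f$. On such a morphism, $K(\phi)$ is the restriction $f^{-1}(1)\to f'^{-1}(1)$ of $\phi$. *)

theory Defs
  imports "HOL-Algebra.Group"
begin

section \<open>Categories, functors and equivalences\<close>

text \<open>Hom-sets need not be disjoint, so identities, composition and the action of a functor on
  morphisms carry the objects involved as arguments: \<open>Comp C X Y Z g f\<close> is the composite
  \<open>X \<rightarrow> Y \<rightarrow> Z\<close> of \<open>f\<close> followed by \<open>g\<close>.\<close>

record ('o, 'm) cat =
  Ob :: "'o set"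
  Hom :: "'o \<Rightarrow> 'o \<Rightarrow> 'm set"
  Ident :: "'o \<Rightarrow> 'm"
  Comp :: "'o \<Rightarrow> 'o \<Rightarrow> 'o \<Rightarrow> 'm \<Rightarrow> 'm \<Rightarrow> 'm"

locale category =
  fixes C :: "('o, 'm) cat"
  assumes Ident_Hom: "X \<in> Ob C \<Longrightarrow> Ident C X \<in> Hom C X X"
    and Comp_Hom: "\<lbrakk>X \<in> Ob C; Y \<in> Ob C; Z \<in> Ob C; f \<in> Hom C X Y; g \<in> Hom C Y Z\<rbrakk>
      \<Longrightarrow> Comp C X Y Z g f \<in> Hom C X Z"
    and Comp_Ident_right: "\<lbrakk>X \<in> Ob C; Y \<in> Ob C; f \<in> Hom C X Y\<rbrakk>
      \<Longrightarrow> Comp C X X Y f (Ident C X) = f"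
    and Comp_Ident_left: "\<lbrakk>X \<in> Ob C; Y \<in> Ob C; f \<in> Hom C X Y\<rbrakk>
      \<Longrightarrow> Comp C X Y Y (Ident C Y) f = f"
    and Comp_assoc: "\<lbrakk>W \<in> Ob C; X \<in> Ob C; Y \<in> Ob C; Z \<in> Ob C;
        f \<in> Hom C W X; g \<in> Hom C X Y; h \<in> Hom C Y Z\<rbrakk>
      \<Longrightarrow> Comp C W Y Z h (Comp C W X Y g f) = Comp C W X Z (Comp C X Y Z h g) f"

record ('o1, 'm1, 'o2, 'm2) fctr =
  on_Ob :: "'o1 \<Rightarrow> 'o2"
  on_Hom :: "'o1 \<Rightarrow> 'o1 \<Rightarrow> 'm1 \<Rightarrow> 'm2"

locale cat_functor = dom: category C + cod: category D
  for C :: "('o1, 'm1) cat" and D :: "('o2, 'm2) cat" +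
  fixes F :: "('o1, 'm1, 'o2, 'm2) fctr"
  assumes on_Ob_Ob: "X \<in> Ob C \<Longrightarrow> on_Ob F X \<in> Ob D"
    and on_Hom_Hom: "\<lbrakk>X \<in> Ob C; Y \<in> Ob C; f \<in> Hom C X Y\<rbrakk>
      \<Longrightarrow> on_Hom F X Y f \<in> Hom D (on_Ob F X) (on_Ob F Y)"
    and on_Hom_Ident: "X \<in> Ob C \<Longrightarrow> on_Hom F X X (Ident C X) = Ident D (on_Ob F X)"
    and on_Hom_Comp: "\<lbrakk>X \<in> Ob C; Y \<in> Ob C; Z \<in> Ob C; f \<in> Hom C X Y; g \<in> Hom C Y Z\<rbrakk>
      \<Longrightarrow> on_Hom F X Z (Comp C X Y Z g f)
        = Comp D (on_Ob F X) (on_Ob F Y) (on_Ob F Z) (on_Hom F Y Z g) (on_Hom F X Y f)"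

definition id_functor :: "('o, 'm, 'o, 'm) fctr" where
  "id_functor = \<lparr>on_Ob = (\<lambda>X. X), on_Hom = (\<lambda>X Y f. f)\<rparr>"

definition comp_functor ::
  "('o2, 'm2, 'o3, 'm3) fctr \<Rightarrow> ('o1, 'm1, 'o2, 'm2) fctr \<Rightarrow> ('o1, 'm1, 'o3, 'm3) fctr" where
  "comp_functor G F =
     \<lparr>on_Ob = (\<lambda>X. on_Ob G (on_Ob F X)),
      on_Hom = (\<lambda>X Y f. on_Hom G (on_Ob F X) (on_Ob F Y) (on_Hom F X Y f))\<rparr>"

definition is_iso :: "('o, 'm) cat \<Rightarrow> 'o \<Rightarrow> 'o \<Rightarrow> 'm \<Rightarrow> bool" where
  "is_iso C X Y f \<longleftrightarrow> f \<in> Hom C X Y \<and>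
     (\<exists>g\<in>Hom C Y X. Comp C X Y X g f = Ident C X \<and> Comp C Y X Y f g = Ident C Y)"

locale natural_iso = src: cat_functor C D F + tgt: cat_functor C D G
  for C :: "('o1, 'm1) cat" and D :: "('o2, 'm2) cat"
    and F G :: "('o1, 'm1, 'o2, 'm2) fctr" +
  fixes t :: "'o1 \<Rightarrow> 'm2"
  assumes component_iso: "X \<in> Ob C \<Longrightarrow> is_iso D (on_Ob F X) (on_Ob G X) (t X)"
    and naturality: "\<lbrakk>X \<in> Ob C; Y \<in> Ob C; f \<in> Hom C X Y\<rbrakk>
      \<Longrightarrow> Comp D (on_Ob F X) (on_Ob F Y) (on_Ob G Y) (t Y) (on_Hom F X Y f)
        = Comp D (on_Ob F X) (on_Ob G X) (on_Ob G Y) (on_Hom G X Y f) (t X)"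

definition equivalence_of_categories ::
  "('o1, 'm1) cat \<Rightarrow> ('o2, 'm2) cat \<Rightarrow> ('o1, 'm1, 'o2, 'm2) fctr \<Rightarrow> bool" where
  "equivalence_of_categories C D F \<longleftrightarrow>
     cat_functor C D F \<and>
     (\<exists>G \<eta> \<epsilon>. cat_functor D C G \<and>
        natural_iso C C id_functor (comp_functor G F) \<eta> \<and>
        natural_iso D D (comp_functor F G) id_functor \<epsilon>)"


section \<open>Wajsberg hoops\<close>

record 'a hoop = "'a monoid" +
  imp :: "'a \<Rightarrow> 'a \<Rightarrow> 'a"  (infixr \<open>\<leadsto>\<index>\<close> 65)

locale hoop = comm_monoid H for H :: "('a, 'b) hoop_scheme" (structure) +
  assumes imp_closed: "\<lbrakk>x \<in> carrier H; y \<in> carrier H\<rbrakk> \<Longrightarrow> x \<leadsto> y \<in> carrier H"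
    and imp_self: "x \<in> carrier H \<Longrightarrow> x \<leadsto> x = \<one>"
    and divisibility: "\<lbrakk>x \<in> carrier H; y \<in> carrier H\<rbrakk>
      \<Longrightarrow> x \<otimes> (x \<leadsto> y) = y \<otimes> (y \<leadsto> x)"
    and currying: "\<lbrakk>x \<in> carrier H; y \<in> carrier H; z \<in> carrier H\<rbrakk>
      \<Longrightarrow> (x \<otimes> y) \<leadsto> z = x \<leadsto> (y \<leadsto> z)"

locale wajsberg_hoop = hoop +
  assumes wajsberg: "\<lbrakk>x \<in> carrier H; y \<in> carrier H\<rbrakk>
      \<Longrightarrow> (x \<leadsto> y) \<leadsto> y = (y \<leadsto> x) \<leadsto> x"

text \<open>Homomorphisms are extensional outside the carrier, so that equality of functions is
  equality of homomorphisms; accordingly they are composed with \<^const>\<open>compose\<close>.\<close>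

definition hoop_hom :: "'a hoop \<Rightarrow> 'b hoop \<Rightarrow> ('a \<Rightarrow> 'b) set" where
  "hoop_hom H H' = {h \<in> carrier H \<rightarrow>\<^sub>E carrier H'.
     (\<forall>x\<in>carrier H. \<forall>y\<in>carrier H. h (x \<otimes>\<^bsub>H\<^esub> y) = h x \<otimes>\<^bsub>H'\<^esub> h y) \<and>
     (\<forall>x\<in>carrier H. \<forall>y\<in>carrier H. h (x \<leadsto>\<^bsub>H\<^esub> y) = h x \<leadsto>\<^bsub>H'\<^esub> h y) \<and>
     h \<one>\<^bsub>H\<^esub> = \<one>\<^bsub>H'\<^esub>}"

definition hoop_kernel :: "'a hoop \<Rightarrow> 'b hoop \<Rightarrow> ('a \<Rightarrow> 'b) \<Rightarrow> 'a hoop" where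
  "hoop_kernel H H' h = H\<lparr>carrier := {x \<in> carrier H. h x = \<one>\<^bsub>H'\<^esub>}\<rparr>"

text \<open>The objects are the Wajsberg hoops whose carrier is a subset of the type \<open>'a\<close>, which plays
  the role of the universe. As usual for carrier-based structures, the operations are unconstrained
  outside the carrier. When \<open>'a\<close> is finite the universe is too small for the kernel functor to be
  essentially surjective, since a hoop with \<open>n\<close> elements is the kernel of an MV-algebra with \<open>2n\<close>
  elements only.\<close>

definition WHoops :: "('a hoop, 'a \<Rightarrow> 'a) cat" where
  "WHoops =
     \<lparr>Ob = {H. wajsberg_hoop H},
      Hom = hoop_hom,
      Ident = (\<lambda>H. \<lambda>x\<in>carrier H. x),
      Comp = (\<lambda>H H' H'' g f. compose (carrier H) g f)\<rparr>"


section \<open>MV-algebras\<close>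

record 'a mv_algebra = "'a partial_object" +
  mv_plus :: "'a \<Rightarrow> 'a \<Rightarrow> 'a"  (infixl \<open>\<boxplus>\<index>\<close> 65)
  mv_neg :: "'a \<Rightarrow> 'a"  (\<open>\<sim>\<index> _\<close> [81] 80)
  mv_zero :: 'a  (\<open>\<zero>\<^sub>m\<index>\<close>)

locale mv_algebra =
  fixes A :: "('a, 'b) mv_algebra_scheme" (structure)
  assumes plus_closed: "\<lbrakk>x \<in> carrier A; y \<in> carrier A\<rbrakk> \<Longrightarrow> x \<boxplus> y \<in> carrier A"
    and neg_closed: "x \<in> carrier A \<Longrightarrow> \<sim> x \<in> carrier A"
    and zero_closed: "\<zero>\<^sub>m \<in> carrier A"
    and plus_assoc: "\<lbrakk>x \<in> carrier A; y \<in> carrier A; z \<in> carrier A\<rbrakk>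
      \<Longrightarrow> x \<boxplus> (y \<boxplus> z) = (x \<boxplus> y) \<boxplus> z"
    and plus_comm: "\<lbrakk>x \<in> carrier A; y \<in> carrier A\<rbrakk> \<Longrightarrow> x \<boxplus> y = y \<boxplus> x"
    and plus_zero: "x \<in> carrier A \<Longrightarrow> x \<boxplus> \<zero>\<^sub>m = x"
    and neg_neg: "x \<in> carrier A \<Longrightarrow> \<sim> (\<sim> x) = x"
    and plus_neg_zero: "x \<in> carrier A \<Longrightarrow> x \<boxplus> (\<sim> \<zero>\<^sub>m) = \<sim> \<zero>\<^sub>m"
    and lukasiewicz: "\<lbrakk>x \<in> carrier A; y \<in> carrier A\<rbrakk>
      \<Longrightarrow> \<sim> (\<sim> x \<boxplus> y) \<boxplus> y = \<sim> (\<sim> y \<boxplus> x) \<boxplus> x"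

definition mv_hom :: "'a mv_algebra \<Rightarrow> 'b mv_algebra \<Rightarrow> ('a \<Rightarrow> 'b) set" where
  "mv_hom A B = {h \<in> carrier A \<rightarrow>\<^sub>E carrier B.
     (\<forall>x\<in>carrier A. \<forall>y\<in>carrier A. h (x \<boxplus>\<^bsub>A\<^esub> y) = h x \<boxplus>\<^bsub>B\<^esub> h y) \<and>
     (\<forall>x\<in>carrier A. h (\<sim>\<^bsub>A\<^esub> x) = \<sim>\<^bsub>B\<^esub> (h x)) \<and>
     h \<zero>\<^sub>m\<^bsub>A\<^esub> = \<zero>\<^sub>m\<^bsub>B\<^esub>}"

definition mv_to_hoop :: "'a mv_algebra \<Rightarrow> 'a hoop" where
  "mv_to_hoop A =
     \<lparr>carrier = carrier A,
      mult = (\<lambda>x y. \<sim>\<^bsub>A\<^esub> ((\<sim>\<^bsub>A\<^esub> x) \<boxplus>\<^bsub>A\<^esub> (\<sim>\<^bsub>A\<^esub> y))),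
      one = \<sim>\<^bsub>A\<^esub> \<zero>\<^sub>m\<^bsub>A\<^esub>,
      imp = (\<lambda>x y. (\<sim>\<^bsub>A\<^esub> x) \<boxplus>\<^bsub>A\<^esub> y)\<rparr>"

definition mv_two :: "bool mv_algebra" where
  "mv_two = \<lparr>carrier = UNIV, mv_plus = (\<or>), mv_neg = Not, mv_zero = False\<rparr>"

lemma mv_algebra_mv_two: "mv_algebra mv_two"
  by unfold_locales (auto simp: mv_two_def)


section \<open>The slice over the two-element algebra and the kernel functor\<close>

text \<open>An object \<open>f : A \<rightarrow> \<two>\<close> of the slice is the pair \<open>(A, f)\<close>. The algebra \<^const>\<open>mv_two\<close> lives on
  \<^typ>\<open>bool\<close> rather than in the universe \<open>'a\<close>.\<close>

definition MVAlg_over_two :: "('a mv_algebra \<times> ('a \<Rightarrow> bool), 'a \<Rightarrow> 'a) cat" where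
  "MVAlg_over_two =
     \<lparr>Ob = {(A, f). mv_algebra A \<and> f \<in> mv_hom A mv_two},
      Hom = (\<lambda>(A, f) (A', f'). {\<phi> \<in> mv_hom A A'. compose (carrier A) f' \<phi> = f}),
      Ident = (\<lambda>(A, f). \<lambda>x\<in>carrier A. x),
      Comp = (\<lambda>(A, f) (A', f') (A'', f'') \<psi> \<phi>. compose (carrier A) \<psi> \<phi>)\<rparr>"

definition mv_Ker :: "'a mv_algebra \<times> ('a \<Rightarrow> bool) \<Rightarrow> 'a hoop" where
  "mv_Ker = (\<lambda>(A, f). hoop_kernel (mv_to_hoop A) (mv_to_hoop mv_two) f)"

definition kernel_functor ::
  "('a mv_algebra \<times> ('a \<Rightarrow> bool), 'a \<Rightarrow> 'a, 'a hoop, 'a \<Rightarrow> 'a) fctr" where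
  "kernel_functor =
     \<lparr>on_Ob = mv_Ker,
      on_Hom = (\<lambda>X Y \<phi>. restrict \<phi> (carrier (mv_Ker X)))\<rparr>"

end

theory Submission
  imports Defs
begin

text \<open>For an MV-homomorphism \<open>f : A \<rightarrow> \<two>\<close>, each element of \<open>A\<close> is either in \<open>F = f\<^sup>-\<^sup>1(1)\<close> or the
  negation of an element of \<open>F\<close>, so \<open>f\<close> and the hoop \<open>F\<close> determine \<open>A\<close> once sums of elements of
  \<open>F\<close> are expressed in the language of hoops: \<open>a \<oplus> b = (a \<rightarrow> a \<odot> b) \<rightarrow> b\<close>, and
  \<open>a \<oplus> \<not> b = b \<rightarrow> a\<close>, \<open>\<not> a \<oplus> \<not> b = \<not> (a \<odot> b)\<close>. Hence a hoop homomorphism between kernels extends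
  uniquely, and the same formulas turn two disjoint copies of a Wajsberg hoop \<open>H\<close> into an
  MV-algebra over \<open>\<two>\<close> with kernel \<open>H\<close>. The axioms for the latter hold because a finite set of
  elements lies in an interval \<open>[c, 1]\<close>, with \<open>c\<close> the product of the elements, where
  \<open>a \<oplus> b = (a \<rightarrow> c) \<rightarrow> b\<close>.\<close>


section \<open>Wajsberg hoops and their sum operation\<close>

context hoop
begin

text \<open>Currying with the unit gives \<open>x \<leadsto> (\<one> \<leadsto> x) = \<one>\<close>
  and \<open>(\<one> \<leadsto> x) \<leadsto> x = \<one>\<close>; divisibility makes this order
  antisymmetric.\<close>

lemma one_imp:
  assumes x: "x \<in> carrier H"
  shows "\<one> \<leadsto> x = x"
proof -
  let ?u = "\<one> \<leadsto> x"
  have u: "?u \<in> carrier H" using x by (simp add: imp_closed)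
  have le: "x \<leadsto> ?u = \<one>" using currying[of x \<one> x] x by (simp add: imp_self)
  have ge: "?u \<leadsto> x = \<one>" using currying[of ?u \<one> x] x u by (simp add: imp_self)
  show ?thesis using divisibility[OF x u] le ge x u by simp
qed

text \<open>Divisibility against the unit shows that \<open>x\<close> absorbs
  \<open>x \<leadsto> \<one>\<close>; by currying, \<open>x \<leadsto> \<one>\<close> then equals
  its own self-implication.\<close>

lemma imp_one:
  assumes x: "x \<in> carrier H"
  shows "x \<leadsto> \<one> = \<one>"
proof -
  let ?u = "x \<leadsto> \<one>"
  have u: "?u \<in> carrier H" using x by (simp add: imp_closed)
  have absorb: "?u \<otimes> x = x"
    using divisibility[OF x one_closed] x u by (simp add: one_imp m_comm)
  have "?u \<leadsto> ?u = (?u \<otimes> x) \<leadsto> \<one>" using currying[OF u x one_closed] by simp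
  then show ?thesis using absorb u by (simp add: imp_self)
qed

lemma imp_swap:
  "\<lbrakk>x \<in> carrier H; y \<in> carrier H; z \<in> carrier H\<rbrakk> \<Longrightarrow> x \<leadsto> (y \<leadsto> z) = y \<leadsto> (x \<leadsto> z)"
  by (metis currying m_comm)

lemma imp_imp_left:
  "\<lbrakk>x \<in> carrier H; y \<in> carrier H\<rbrakk> \<Longrightarrow> x \<leadsto> (y \<leadsto> x) = \<one>"
  by (simp add: imp_swap[of x y x] imp_self imp_one)

lemma mult_imp_left:
  "\<lbrakk>x \<in> carrier H; y \<in> carrier H\<rbrakk> \<Longrightarrow> (x \<otimes> y) \<leadsto> x = \<one>"
  by (simp add: currying imp_imp_left)

text \<open>An inequality in the order \<open>x \<leadsto> y = \<one>\<close> is a divisibility; the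
  explicit cofactor helps to supply the parameter \<open>p\<close> of
  \<open>hoop_plus_eq\<close>.\<close>

lemma factor_of_le:
  "\<lbrakk>x \<in> carrier H; y \<in> carrier H; x \<leadsto> y = \<one>\<rbrakk> \<Longrightarrow> x = y \<otimes> (y \<leadsto> x)"
  using divisibility[of x y] by simp

end

text \<open>In an MV-algebra this term equals \<open>a \<oplus> b\<close>, because \<open>a \<rightarrow> a \<odot> b = \<not> a \<or> b\<close>.\<close>

definition hoop_plus :: "('a, 'b) hoop_scheme \<Rightarrow> 'a \<Rightarrow> 'a \<Rightarrow> 'a" where
  "hoop_plus H a b = (a \<leadsto>\<^bsub>H\<^esub> (a \<otimes>\<^bsub>H\<^esub> b)) \<leadsto>\<^bsub>H\<^esub> b"

context wajsberg_hoop
begin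

lemma hoop_plus_closed:
  "\<lbrakk>a \<in> carrier H; b \<in> carrier H\<rbrakk> \<Longrightarrow> hoop_plus H a b \<in> carrier H"
  by (simp add: hoop_plus_def imp_closed)

text \<open>The Wajsberg law turns the left side into \<open>(c \<leadsto> x) \<leadsto> x\<close>.
  Hence \<open>x \<mapsto> x \<leadsto> c\<close> is an involution on the elements above
  \<open>c\<close>.\<close>

lemma double_imp:
  "\<lbrakk>c \<in> carrier H; x \<in> carrier H; c \<leadsto> x = \<one>\<rbrakk> \<Longrightarrow> (x \<leadsto> c) \<leadsto> c = x"
  by (simp add: wajsberg[of x c] one_imp)

lemma triple_imp:
  assumes "x \<in> carrier H" "y \<in> carrier H"
  shows "((x \<leadsto> y) \<leadsto> y) \<leadsto> y = x \<leadsto> y"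
  by (rule double_imp) (use assms in \<open>simp_all add: imp_closed imp_imp_left\<close>)

text \<open>The interval \<open>[c, 1]\<close> is an MV-algebra with negation \<open>x \<mapsto> x \<rightarrow> c\<close>, and for \<open>c \<le> a \<otimes> b\<close> its
  sum does not depend on \<open>c\<close>.\<close>

lemma hoop_plus_eq:
  assumes a: "a \<in> carrier H" and b: "b \<in> carrier H" and p: "p \<in> carrier H"
    and c: "c = (a \<otimes> b) \<otimes> p"
  shows "hoop_plus H a b = (a \<leadsto> c) \<leadsto> b"
proof -
  have cc: "c \<in> carrier H" using a b p c by simp
  have ab: "a \<otimes> b \<in> carrier H" using a b by simp
  note cl = a b cc ab imp_closed
  have le: "c \<leadsto> (a \<otimes> b) = \<one>" unfolding c by (rule mult_imp_left[OF ab p])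
  \<comment> \<open>The join of \<open>a \<leadsto> c\<close> and \<open>b\<close> does not depend
    on \<open>c\<close>: the Wajsberg law exchanges their roles, and then \<open>double_imp\<close>
    cancels \<open>c\<close>. Implying \<open>b\<close> once more collapses a triple
    implication.\<close>
  have "((a \<leadsto> c) \<leadsto> b) \<leadsto> b = (b \<leadsto> (a \<leadsto> c)) \<leadsto> (a \<leadsto> c)"
    using cl by (intro wajsberg) auto
  also have "\<dots> = ((a \<otimes> b) \<leadsto> c) \<leadsto> (a \<leadsto> c)"
    using cl by (simp add: currying imp_swap[of a b c])
  also have "\<dots> = a \<leadsto> (((a \<otimes> b) \<leadsto> c) \<leadsto> c)"
    using cl by (intro imp_swap) auto
  also have "\<dots> = a \<leadsto> (a \<otimes> b)" using double_imp[OF cc ab le] by simp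
  finally have "a \<leadsto> (a \<otimes> b) = ((a \<leadsto> c) \<leadsto> b) \<leadsto> b" by simp
  then show ?thesis
    unfolding hoop_plus_def using triple_imp[of "a \<leadsto> c" b] cl by simp
qed

text \<open>Replacing \<open>b\<close> by its double negation relative to \<open>c\<close> makes the
  formula symmetric up to \<open>imp_swap\<close>.\<close>

lemma hoop_plus_sym_eq:
  assumes a: "a \<in> carrier H" and b: "b \<in> carrier H" and p: "p \<in> carrier H"
    and c: "c = (a \<otimes> b) \<otimes> p"
  shows "hoop_plus H a b = (a \<leadsto> c) \<leadsto> ((b \<leadsto> c) \<leadsto> c)"
proof -
  have "c = b \<otimes> (a \<otimes> p)" using a b p c by (simp add: m_ac)
  then have "(b \<leadsto> c) \<leadsto> c = b"
    using a b p by (intro double_imp) (auto simp: mult_imp_left)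
  then show ?thesis using hoop_plus_eq[OF assms] by simp
qed

lemma hoop_plus_comm:
  assumes a: "a \<in> carrier H" and b: "b \<in> carrier H"
  shows "hoop_plus H a b = hoop_plus H b a"
proof -
  let ?c = "a \<otimes> b"
  have "hoop_plus H a b = (a \<leadsto> ?c) \<leadsto> ((b \<leadsto> ?c) \<leadsto> ?c)"
    using a b by (intro hoop_plus_sym_eq[of _ _ \<one>]) auto
  also have "\<dots> = (b \<leadsto> ?c) \<leadsto> ((a \<leadsto> ?c) \<leadsto> ?c)"
    using a b by (intro imp_swap) (auto simp: imp_closed)
  also have "\<dots> = hoop_plus H b a"
    using a b by (intro hoop_plus_sym_eq[of _ _ \<one>, symmetric]) (auto simp: m_comm)
  finally show ?thesis .
qed

lemma imp_hoop_plus_right: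
  assumes "a \<in> carrier H" "b \<in> carrier H"
  shows "b \<leadsto> hoop_plus H a b = \<one>"
  using assms by (simp add: hoop_plus_def imp_imp_left imp_closed)

text \<open>This is associativity with one summand a formal negation. As \<open>b\<close> lies below
  \<open>d \<leadsto> b\<close>, the bound \<open>a \<otimes> b\<close> also computes the right-hand
  sum, and the claim becomes an instance of \<open>imp_swap\<close>.\<close>

lemma imp_hoop_plus:
  assumes a: "a \<in> carrier H" and b: "b \<in> carrier H" and d: "d \<in> carrier H"
  shows "d \<leadsto> hoop_plus H a b = hoop_plus H a (d \<leadsto> b)"
proof -
  let ?c = "a \<otimes> b" and ?y = "d \<leadsto> b"
  have y: "?y \<in> carrier H" by (rule imp_closed[OF d b])
  have "b = ?y \<otimes> (?y \<leadsto> b)" using b d y by (intro factor_of_le) (auto simp: imp_imp_left)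
  then have c: "?c = (a \<otimes> ?y) \<otimes> (?y \<leadsto> b)"
    using a b y by (metis imp_closed m_assoc)
  have "d \<leadsto> hoop_plus H a b = d \<leadsto> ((a \<leadsto> ?c) \<leadsto> b)" by (simp add: hoop_plus_def)
  also have "\<dots> = (a \<leadsto> ?c) \<leadsto> ?y" using a b d by (intro imp_swap) (auto simp: imp_closed)
  also have "\<dots> = hoop_plus H a ?y"
    using hoop_plus_eq[OF a y imp_closed[OF y b] c] by simp
  finally show ?thesis .
qed

text \<open>Relative to a common bound, the product of all three elements, an iterated sum is an
  iterated implication, whose premises can be permuted.\<close>

lemma hoop_plus_assoc:
  assumes a: "a \<in> carrier H" and b: "b \<in> carrier H" and d: "d \<in> carrier H"
  shows "hoop_plus H a (hoop_plus H b d) = hoop_plus H (hoop_plus H a b) d"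
proof -
  have expand: "hoop_plus H x (hoop_plus H y z) = (x \<leadsto> c) \<leadsto> ((y \<leadsto> c) \<leadsto> ((z \<leadsto> c) \<leadsto> c))"
    if x: "x \<in> carrier H" and y: "y \<in> carrier H" and z: "z \<in> carrier H"
      and c: "c = x \<otimes> (y \<otimes> z)" for x y z c
  proof -
    let ?s = "hoop_plus H y z"
    have s: "?s \<in> carrier H" using y z by (rule hoop_plus_closed)
    let ?q = "?s \<leadsto> z"
    have q: "?q \<in> carrier H" using s z by (rule imp_closed)
    \<comment> \<open>Since \<open>z\<close> lies below \<open>?s\<close>, it is a multiple of
      \<open>?s\<close>; this displays \<open>c\<close> as a multiple of
      \<open>x \<otimes> ?s\<close>, as \<open>hoop_plus_eq\<close> requires.\<close>
    have "z = ?s \<otimes> ?q"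
      using y z s by (intro factor_of_le) (auto simp: imp_hoop_plus_right)
    then have "c = x \<otimes> (y \<otimes> (?s \<otimes> ?q))" using c by simp
    then have "c = (x \<otimes> ?s) \<otimes> (?q \<otimes> y)" using x y s q by (simp add: m_ac)
    then have "hoop_plus H x ?s = (x \<leadsto> c) \<leadsto> ?s"
      using x y s q by (intro hoop_plus_eq) auto
    moreover have "?s = (y \<leadsto> c) \<leadsto> ((z \<leadsto> c) \<leadsto> c)"
      by (rule hoop_plus_sym_eq[OF y z x]) (use c x y z in \<open>simp add: m_ac\<close>)
    ultimately show ?thesis by simp
  qed
  let ?c = "a \<otimes> (b \<otimes> d)"
  have cc: "?c \<in> carrier H" using a b d by simp
  \<comment> \<open>Commutativity brings the other bracketing into the shape covered by
    \<open>expand\<close>.\<close>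
  have "hoop_plus H (hoop_plus H a b) d = hoop_plus H d (hoop_plus H a b)"
    using a b d by (simp add: hoop_plus_comm hoop_plus_closed)
  also have "\<dots> = (d \<leadsto> ?c) \<leadsto> ((a \<leadsto> ?c) \<leadsto> ((b \<leadsto> ?c) \<leadsto> ?c))"
    using a b d by (intro expand) (auto simp: m_ac)
  also have "\<dots> = (a \<leadsto> ?c) \<leadsto> ((d \<leadsto> ?c) \<leadsto> ((b \<leadsto> ?c) \<leadsto> ?c))"
    using a b d cc by (intro imp_swap) (auto simp: imp_closed)
  also have "\<dots> = (a \<leadsto> ?c) \<leadsto> ((b \<leadsto> ?c) \<leadsto> ((d \<leadsto> ?c) \<leadsto> ?c))"
    using a b d cc imp_swap[of "d \<leadsto> ?c" "b \<leadsto> ?c" ?c] by (simp add: imp_closed)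
  also have "\<dots> = hoop_plus H a (hoop_plus H b d)"
    using a b d by (intro expand[symmetric]) auto
  finally show ?thesis by simp
qed

end

section \<open>MV-algebras and Wajsberg hoops\<close>

context mv_algebra
begin

text \<open>The Lukasiewicz axiom with second argument \<open>\<sim> \<zero>\<^sub>m\<close>: its
  left side is absorbed, its right side simplifies to the sum in question.\<close>

lemma neg_plus_self:
  assumes "x \<in> carrier A"
  shows "\<sim> x \<boxplus> x = \<sim> \<zero>\<^sub>m"
  using lukasiewicz[of x "\<sim> \<zero>\<^sub>m"] assms
  by (simp add: plus_neg_zero neg_neg neg_closed zero_closed plus_comm[of "\<zero>\<^sub>m"] plus_zero)

end

context
  fixes A :: "'a mv_algebra" (structure)
  assumes mv: "mv_algebra A"
begin

interpretation mv_algebra A by (rule mv)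

lemma wajsberg_hoop_mv_to_hoop: "wajsberg_hoop (mv_to_hoop A)"
proof (unfold_locales, goal_cases)
  case (2 x y z)
  then show ?case by (simp add: mv_to_hoop_def neg_neg plus_closed neg_closed plus_assoc)
next
  case (4 x)
  then show ?case
    by (simp add: mv_to_hoop_def neg_neg plus_zero plus_comm[of \<open>\<zero>\<^sub>m\<close>] neg_closed zero_closed)
next
  case (5 x)
  then show ?case by (simp add: mv_to_hoop_def neg_neg plus_zero neg_closed zero_closed)
next
  case (6 x y)
  then show ?case by (simp add: mv_to_hoop_def neg_closed plus_comm[of "\<sim> x"])
next
  \<comment> \<open>Divisibility: the Lukasiewicz axiom at the negated arguments equates the
    negations of the two sides.\<close>
  case (9 x y)
  then show ?case
    using lukasiewicz[of "\<sim> x" "\<sim> y"]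
    by (simp add: mv_to_hoop_def neg_neg neg_closed plus_closed plus_comm)
next
  case (10 x y z)
  then show ?case
    by (simp add: mv_to_hoop_def neg_neg neg_closed plus_closed plus_assoc)
qed (auto simp: mv_to_hoop_def neg_closed zero_closed plus_closed neg_plus_self
      intro: plus_comm lukasiewicz arg_cong[where f = "mv_neg A"])

text \<open>Zero is a multiple of every product, so it can serve as the bound \<open>c\<close> in
  \<open>hoop_plus_eq\<close>, and implication into zero is negation.\<close>

lemma plus_eq_hoop_plus:
  assumes "x \<in> carrier A" "y \<in> carrier A"
  shows "x \<boxplus> y = hoop_plus (mv_to_hoop A) x y"
proof -
  interpret W: wajsberg_hoop "mv_to_hoop A" by (rule wajsberg_hoop_mv_to_hoop)
  let ?H = "mv_to_hoop A"
  have zero: "(x \<otimes>\<^bsub>?H\<^esub> y) \<otimes>\<^bsub>?H\<^esub> \<zero>\<^sub>m = \<zero>\<^sub>m"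
    using assms by (simp add: mv_to_hoop_def neg_neg plus_neg_zero neg_closed zero_closed plus_closed)
  have "hoop_plus ?H x y = (x \<leadsto>\<^bsub>?H\<^esub> \<zero>\<^sub>m) \<leadsto>\<^bsub>?H\<^esub> y"
    using assms zero_closed
    by (intro W.hoop_plus_eq[OF _ _ _ zero[symmetric]]) (auto simp: mv_to_hoop_def)
  also have "\<dots> = x \<boxplus> y"
    using assms by (simp add: mv_to_hoop_def neg_neg plus_zero neg_closed)
  finally show ?thesis by simp
qed

end

section \<open>Kernels over the two-element algebra and the extension of homomorphisms between
  them\<close>

lemma wajsberg_hoop_hoop_kernel:
  fixes H :: "'a hoop" and H' :: "'b hoop"
  assumes "wajsberg_hoop H" "wajsberg_hoop H'" and h: "h \<in> hoop_hom H H'"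
  shows "wajsberg_hoop (hoop_kernel H H' h)"
proof -
  interpret H: wajsberg_hoop H by fact
  interpret H': wajsberg_hoop H' by fact
  show ?thesis
    using h
    by unfold_locales
      (auto simp: hoop_kernel_def hoop_hom_def H.m_assoc H.imp_closed H.imp_self H'.imp_self
        intro: H.m_comm H.divisibility H.currying H.wajsberg)
qed

lemma mv_hom_imp_hoop_hom:
  assumes "mv_algebra A" "mv_algebra B" "h \<in> mv_hom A B"
  shows "h \<in> hoop_hom (mv_to_hoop A) (mv_to_hoop B)"
proof -
  interpret A: mv_algebra A by fact
  show ?thesis
    using assms(3)
    by (auto simp: hoop_hom_def mv_hom_def mv_to_hoop_def A.plus_closed A.neg_closed A.zero_closed)
qed

lemma wajsberg_hoop_mv_Ker:
  assumes "mv_algebra A" "f \<in> mv_hom A mv_two"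
  shows "wajsberg_hoop (mv_Ker (A, f))"
  unfolding mv_Ker_def using assms
  by (auto intro!: wajsberg_hoop_hoop_kernel wajsberg_hoop_mv_to_hoop mv_algebra_mv_two
      mv_hom_imp_hoop_hom)

lemma carrier_mv_Ker: "carrier (mv_Ker (A, f)) = {x \<in> carrier A. f x}"
  by (auto simp: mv_Ker_def hoop_kernel_def mv_to_hoop_def mv_two_def)

lemma mv_Ker_simps:
  "x \<otimes>\<^bsub>mv_Ker (A, f)\<^esub> y = \<sim>\<^bsub>A\<^esub> (\<sim>\<^bsub>A\<^esub> x \<boxplus>\<^bsub>A\<^esub> \<sim>\<^bsub>A\<^esub> y)"
  "x \<leadsto>\<^bsub>mv_Ker (A, f)\<^esub> y = \<sim>\<^bsub>A\<^esub> x \<boxplus>\<^bsub>A\<^esub> y"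
  "\<one>\<^bsub>mv_Ker (A, f)\<^esub> = \<sim>\<^bsub>A\<^esub> \<zero>\<^sub>m\<^bsub>A\<^esub>"
  "hoop_plus (mv_Ker (A, f)) = hoop_plus (mv_to_hoop A)"
  by (auto simp: mv_Ker_def hoop_kernel_def mv_to_hoop_def hoop_plus_def fun_eq_iff)

lemma mv_two_homD:
  assumes "f \<in> mv_hom A mv_two"
  shows "\<And>x y. \<lbrakk>x \<in> carrier A; y \<in> carrier A\<rbrakk> \<Longrightarrow> f (x \<boxplus>\<^bsub>A\<^esub> y) \<longleftrightarrow> f x \<or> f y"
    and "\<And>x. x \<in> carrier A \<Longrightarrow> f (\<sim>\<^bsub>A\<^esub> x) \<longleftrightarrow> \<not> f x"
    and "\<not> f \<zero>\<^sub>m\<^bsub>A\<^esub>"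
  using assms by (auto simp: mv_hom_def mv_two_def)

text \<open>Outside the kernel, \<open>\<sim> x\<close> lies in the kernel, and compatibility with
  negation forces the value chosen here.\<close>

definition hom_extension ::
  "'a mv_algebra \<times> ('a \<Rightarrow> bool) \<Rightarrow> 'b mv_algebra \<Rightarrow> ('a \<Rightarrow> 'b) \<Rightarrow> 'a \<Rightarrow> 'b" where
  "hom_extension = (\<lambda>(A, f) B h. \<lambda>x\<in>carrier A. if f x then h x else \<sim>\<^bsub>B\<^esub> (h (\<sim>\<^bsub>A\<^esub> x)))"

context
  fixes A :: "'a mv_algebra" and B :: "'b mv_algebra" and f g
  assumes A: "mv_algebra A" and B: "mv_algebra B"
    and f: "f \<in> mv_hom A mv_two" and g: "g \<in> mv_hom B mv_two"
begin

interpretation A: mv_algebra A by (rule A)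
interpretation B: mv_algebra B by (rule B)

context
  fixes h
  assumes h: "h \<in> hoop_hom (mv_Ker (A, f)) (mv_Ker (B, g))"
begin

private lemma h_carrier: "\<lbrakk>x \<in> carrier A; f x\<rbrakk> \<Longrightarrow> h x \<in> carrier B \<and> g (h x)"
  using h by (auto simp: hoop_hom_def carrier_mv_Ker)

private lemma h_imp: "\<lbrakk>x \<in> carrier A; f x; y \<in> carrier A; f y\<rbrakk>
    \<Longrightarrow> h (\<sim>\<^bsub>A\<^esub> x \<boxplus>\<^bsub>A\<^esub> y) = \<sim>\<^bsub>B\<^esub> (h x) \<boxplus>\<^bsub>B\<^esub> h y"
  using h by (auto simp: hoop_hom_def carrier_mv_Ker mv_Ker_simps)

private lemma h_mult: "\<lbrakk>x \<in> carrier A; f x; y \<in> carrier A; f y\<rbrakk>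
    \<Longrightarrow> h (\<sim>\<^bsub>A\<^esub> (\<sim>\<^bsub>A\<^esub> x \<boxplus>\<^bsub>A\<^esub> \<sim>\<^bsub>A\<^esub> y)) = \<sim>\<^bsub>B\<^esub> (\<sim>\<^bsub>B\<^esub> (h x) \<boxplus>\<^bsub>B\<^esub> \<sim>\<^bsub>B\<^esub> (h y))"
  using h by (auto simp: hoop_hom_def carrier_mv_Ker mv_Ker_simps)

text \<open>Although the kernel hoop has no sum among its operations, the sum of two of its elements
  is a term in \<open>\<otimes>\<close> and \<open>\<leadsto>\<close>, which \<open>h\<close>
  preserves.\<close>

private lemma h_plus:
  assumes x: "x \<in> carrier A" "f x" and y: "y \<in> carrier A" "f y"
  shows "h (x \<boxplus>\<^bsub>A\<^esub> y) = h x \<boxplus>\<^bsub>B\<^esub> h y"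
proof -
  interpret K: wajsberg_hoop "mv_Ker (A, f)" by (rule wajsberg_hoop_mv_Ker[OF A f])
  have cl: "x \<in> carrier (mv_Ker (A, f))" "y \<in> carrier (mv_Ker (A, f))"
    using x y by (auto simp: carrier_mv_Ker)
  have "h (x \<boxplus>\<^bsub>A\<^esub> y) = h (hoop_plus (mv_Ker (A, f)) x y)"
    using x y by (simp add: plus_eq_hoop_plus[OF A] mv_Ker_simps)
  also have "\<dots> = hoop_plus (mv_Ker (B, g)) (h x) (h y)"
    using h cl by (simp add: hoop_hom_def hoop_plus_def K.imp_closed)
  also have "\<dots> = h x \<boxplus>\<^bsub>B\<^esub> h y"
    using h_carrier x y by (simp add: plus_eq_hoop_plus[OF B] mv_Ker_simps)
  finally show ?thesis .
qed

lemma hom_extension_hom: "hom_extension (A, f) B h \<in> mv_hom A B"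
proof -
  let ?e = "hom_extension (A, f) B h"
  note cl = A.plus_closed A.neg_closed A.zero_closed B.plus_closed B.neg_closed B.zero_closed
  note fD = mv_two_homD[OF f]
  \<comment> \<open>Here the sum is the implication from \<open>\<sim> x\<close> to
    \<open>y\<close>, both in the kernel.\<close>
  have mixed: "?e (x \<boxplus>\<^bsub>A\<^esub> y) = ?e x \<boxplus>\<^bsub>B\<^esub> ?e y"
    if x: "x \<in> carrier A" "\<not> f x" and y: "y \<in> carrier A" "f y" for x y
    using x y h_imp[of "\<sim>\<^bsub>A\<^esub> x" y] by (simp add: hom_extension_def cl fD A.neg_neg)
  have plus: "?e (x \<boxplus>\<^bsub>A\<^esub> y) = ?e x \<boxplus>\<^bsub>B\<^esub> ?e y" if x: "x \<in> carrier A" and y: "y \<in> carrier A" for x y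
  proof (cases "f x"; cases "f y")
    assume "f x" "f y"
    then show ?thesis using x y h_plus by (simp add: hom_extension_def cl fD)
  next
    assume "f x" "\<not> f y"
    then show ?thesis
      using mixed[of y x] x y h_carrier B.plus_comm[of "h x" "\<sim>\<^bsub>B\<^esub> (h (\<sim>\<^bsub>A\<^esub> y))"]
      by (simp add: A.plus_comm[of x y] hom_extension_def cl fD)
  next
    assume "\<not> f x" "f y"
    then show ?thesis using mixed x y by blast
  next
    \<comment> \<open>The sum is now the negation of a product of two kernel elements.\<close>
    assume "\<not> f x" "\<not> f y"
    then show ?thesis
      using x y h_carrier h_mult[of "\<sim>\<^bsub>A\<^esub> x" "\<sim>\<^bsub>A\<^esub> y"]
      by (simp add: hom_extension_def cl fD A.neg_neg B.neg_neg)
  qed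
  have one: "h (\<sim>\<^bsub>A\<^esub> \<zero>\<^sub>m\<^bsub>A\<^esub>) = \<sim>\<^bsub>B\<^esub> \<zero>\<^sub>m\<^bsub>B\<^esub>"
    using h by (simp add: hoop_hom_def mv_Ker_simps)
  have closed: "?e x \<in> carrier B" if "x \<in> carrier A" for x
    using that h_carrier[of x] h_carrier[of "\<sim>\<^bsub>A\<^esub> x"] by (simp add: hom_extension_def cl fD)
  have neg: "?e (\<sim>\<^bsub>A\<^esub> x) = \<sim>\<^bsub>B\<^esub> (?e x)" if "x \<in> carrier A" for x
    using that h_carrier[of "\<sim>\<^bsub>A\<^esub> x"]
    by (simp add: hom_extension_def cl fD A.neg_neg B.neg_neg)
  have zero: "?e \<zero>\<^sub>m\<^bsub>A\<^esub> = \<zero>\<^sub>m\<^bsub>B\<^esub>"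
    by (simp add: hom_extension_def cl fD one B.neg_neg)
  have ext: "?e \<in> extensional (carrier A)" by (simp add: hom_extension_def)
  show ?thesis
    unfolding mv_hom_def PiE_def
    by (intro CollectI IntI conjI ballI Pi_I) (fact closed plus neg zero ext)+
qed

text \<open>The values of \<open>h\<close> lie in the kernel of \<open>g\<close>, so
  \<open>g\<close> is true on them and false on their negations. The extension is thus a morphism of
  the slice.\<close>

lemma compose_hom_extension: "compose (carrier A) g (hom_extension (A, f) B h) = f"
proof (rule extensionalityI[where A = "carrier A"])
  fix x assume x: "x \<in> carrier A"
  show "compose (carrier A) g (hom_extension (A, f) B h) x = f x"
  proof (cases "f x")
    case True
    then show ?thesis using x h_carrier[of x] by (simp add: compose_def hom_extension_def)
  next
    case False
    then have "h (\<sim>\<^bsub>A\<^esub> x) \<in> carrier B" "g (h (\<sim>\<^bsub>A\<^esub> x))"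
      using x h_carrier[of "\<sim>\<^bsub>A\<^esub> x"] by (simp_all add: mv_two_homD[OF f] A.neg_closed)
    then show ?thesis
      using False x by (simp add: compose_def hom_extension_def mv_two_homD[OF g])
  qed
qed (use f in \<open>auto simp: mv_hom_def PiE_def\<close>)

lemma restrict_hom_extension: "restrict (hom_extension (A, f) B h) (carrier (mv_Ker (A, f))) = h"
  using h
  by (auto simp: hom_extension_def carrier_mv_Ker hoop_hom_def PiE_def extensional_def fun_eq_iff)

end

text \<open>Negation moves any element outside the kernel into it and is injective on
  \<open>B\<close>; this yields faithfulness.\<close>

lemma mv_hom_eqI:
  assumes \<phi>: "\<phi> \<in> mv_hom A B" and \<psi>: "\<psi> \<in> mv_hom A B"
    and eq: "restrict \<phi> (carrier (mv_Ker (A, f))) = restrict \<psi> (carrier (mv_Ker (A, f)))"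
  shows "\<phi> = \<psi>"
proof (rule extensionalityI[where A = "carrier A"])
  fix x assume x: "x \<in> carrier A"
  have *: "\<phi> y = \<psi> y" if "y \<in> carrier A" "f y" for y
    using fun_cong[OF eq, of y] that by (simp add: carrier_mv_Ker)
  show "\<phi> x = \<psi> x"
  proof (cases "f x")
    case False
    then have "\<phi> (\<sim>\<^bsub>A\<^esub> x) = \<psi> (\<sim>\<^bsub>A\<^esub> x)"
      using x mv_two_homD[OF f] by (intro *) (auto simp: A.neg_closed)
    then have "\<sim>\<^bsub>B\<^esub> (\<phi> x) = \<sim>\<^bsub>B\<^esub> (\<psi> x)" using x \<phi> \<psi> by (simp add: mv_hom_def)
    moreover have "\<phi> x \<in> carrier B" "\<psi> x \<in> carrier B" using x \<phi> \<psi> by (auto simp: mv_hom_def)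
    ultimately show ?thesis by (metis B.neg_neg)
  qed (use x * in auto)
qed (use \<phi> \<psi> in \<open>auto simp: mv_hom_def PiE_def\<close>)

end

section \<open>The MV-closure of a Wajsberg hoop\<close>

text \<open>The pair \<open>(a, True)\<close> stands for \<open>a\<close> and \<open>(a, False)\<close> for its formal negation; the mixed sums
  come from \<open>a \<oplus> \<not> b = b \<rightarrow> a\<close>.\<close>

definition mv_closure :: "'a hoop \<Rightarrow> ('a \<times> bool) mv_algebra" where
  "mv_closure H =
     \<lparr>carrier = carrier H \<times> UNIV,
      mv_plus = (\<lambda>(a, p) (b, q).
        if p then if q then (hoop_plus H a b, True) else (b \<leadsto>\<^bsub>H\<^esub> a, True)
        else if q then (a \<leadsto>\<^bsub>H\<^esub> b, True) else (a \<otimes>\<^bsub>H\<^esub> b, False)),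
      mv_neg = (\<lambda>(a, p). (a, \<not> p)),
      mv_zero = (\<one>\<^bsub>H\<^esub>, False)\<rparr>"

lemma mv_closure_simps:
  "carrier (mv_closure H) = carrier H \<times> UNIV"
  "(a, True) \<boxplus>\<^bsub>mv_closure H\<^esub> (b, True) = (hoop_plus H a b, True)"
  "(a, True) \<boxplus>\<^bsub>mv_closure H\<^esub> (b, False) = (b \<leadsto>\<^bsub>H\<^esub> a, True)"
  "(a, False) \<boxplus>\<^bsub>mv_closure H\<^esub> (b, True) = (a \<leadsto>\<^bsub>H\<^esub> b, True)"
  "(a, False) \<boxplus>\<^bsub>mv_closure H\<^esub> (b, False) = (a \<otimes>\<^bsub>H\<^esub> b, False)"
  "\<sim>\<^bsub>mv_closure H\<^esub> (a, p) = (a, \<not> p)"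
  "\<zero>\<^sub>m\<^bsub>mv_closure H\<^esub> = (\<one>\<^bsub>H\<^esub>, False)"
  by (auto simp: mv_closure_def)

text \<open>Splitting on the signs of the arguments reduces each axiom to identities in
  \<open>H\<close>.\<close>

lemma mv_algebra_mv_closure:
  assumes "wajsberg_hoop H"
  shows "mv_algebra (mv_closure H)"
proof -
  interpret wajsberg_hoop H by fact
  note cl = imp_closed hoop_plus_closed
  \<comment> \<open>The Lukasiewicz axiom for arguments of opposite sign; equal signs give
    \<open>wajsberg\<close> and \<open>divisibility\<close>. It holds because \<open>a\<close> lies
    below \<open>b \<leadsto> (b \<otimes> a)\<close>, so \<open>double_imp\<close> applies.\<close>
  have join: "b \<leadsto>\<^bsub>H\<^esub> (a \<otimes>\<^bsub>H\<^esub> b) = hoop_plus H b a \<leadsto>\<^bsub>H\<^esub> a"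
    if a: "a \<in> carrier H" and b: "b \<in> carrier H" for a b
  proof -
    have "a \<leadsto>\<^bsub>H\<^esub> (b \<leadsto>\<^bsub>H\<^esub> (b \<otimes>\<^bsub>H\<^esub> a)) = \<one>\<^bsub>H\<^esub>"
      using a b by (simp add: currying[symmetric] m_comm imp_self)
    then show ?thesis
      using a b double_imp[of a "b \<leadsto>\<^bsub>H\<^esub> (b \<otimes>\<^bsub>H\<^esub> a)"]
      by (simp add: hoop_plus_def m_comm cl)
  qed
  have imp_hoop_plus_left:
    "hoop_plus H (d \<leadsto>\<^bsub>H\<^esub> a) b = d \<leadsto>\<^bsub>H\<^esub> hoop_plus H a b"
    if "a \<in> carrier H" "b \<in> carrier H" "d \<in> carrier H" for a b d
    using imp_hoop_plus[OF that(2,1,3)] hoop_plus_comm[of b a]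
      hoop_plus_comm[of "d \<leadsto>\<^bsub>H\<^esub> a" b] that
    by (simp add: cl)
  show ?thesis
  proof (unfold_locales, goal_cases)
    \<comment> \<open>With no negative argument this is \<open>hoop_plus_assoc\<close>, with one
      \<open>imp_hoop_plus\<close>, with two currying up to \<open>imp_swap\<close>, with three
      \<open>m_assoc\<close>.\<close>
    case (4 x y z)
    then obtain a p b q c r where "x = (a, p)" "y = (b, q)" "z = (c, r)"
      and "a \<in> carrier H" "b \<in> carrier H" "c \<in> carrier H"
      by (auto simp: mv_closure_simps)
    then show ?case
      by (cases p; cases q; cases r)
        (simp_all add: mv_closure_simps hoop_plus_assoc imp_hoop_plus[symmetric] imp_hoop_plus_left
          m_assoc currying imp_swap[of a c b] imp_swap[of b c a] cl)
  next
    case (9 x y)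
    then obtain a p b q where "x = (a, p)" "y = (b, q)"
      and "a \<in> carrier H" "b \<in> carrier H"
      by (auto simp: mv_closure_simps)
    then show ?case
      using join[of a b] join[of b a]
      by (cases p; cases q)
        (auto simp: mv_closure_simps wajsberg m_comm divisibility cl)
  next
    case (5 x y)
    then show ?case
      by (cases "snd x"; cases "snd y")
        (auto simp: mv_closure_simps m_comm hoop_plus_comm)
  next
    case (8 x)
    then show ?case
      by (cases "snd x")
        (auto simp: mv_closure_simps hoop_plus_def imp_self imp_one)
  next
    case (6 x)
    then show ?case
      by (cases "snd x") (auto simp: mv_closure_simps one_imp)
  next
    case (1 x y)
    then show ?case
      by (cases "snd x"; cases "snd y") (auto simp: mv_closure_simps cl)
  qed (auto simp: mv_closure_simps)
qed

text \<open>Transport of structure along an injection \<open>j\<close>, needed because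
  \<open>mv_closure H\<close> lives on pairs while the objects of the slice must live on the type of
  \<open>H\<close>.\<close>

definition mv_image :: "('a \<Rightarrow> 'b) \<Rightarrow> 'a mv_algebra \<Rightarrow> 'b mv_algebra" where
  "mv_image j A =
     \<lparr>carrier = j ` carrier A,
      mv_plus = (\<lambda>x y. j (inv_into UNIV j x \<boxplus>\<^bsub>A\<^esub> inv_into UNIV j y)),
      mv_neg = (\<lambda>x. j (\<sim>\<^bsub>A\<^esub> (inv_into UNIV j x))),
      mv_zero = j \<zero>\<^sub>m\<^bsub>A\<^esub>\<rparr>"

lemma mv_image_simps:
  assumes "inj j"
  shows "carrier (mv_image j A) = j ` carrier A"
    "j x \<boxplus>\<^bsub>mv_image j A\<^esub> j y = j (x \<boxplus>\<^bsub>A\<^esub> y)"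
    "\<sim>\<^bsub>mv_image j A\<^esub> (j x) = j (\<sim>\<^bsub>A\<^esub> x)"
    "\<zero>\<^sub>m\<^bsub>mv_image j A\<^esub> = j \<zero>\<^sub>m\<^bsub>A\<^esub>"
  using assms by (auto simp: mv_image_def)

lemma mv_algebra_mv_image:
  assumes "mv_algebra A" "inj j"
  shows "mv_algebra (mv_image j A)"
proof -
  interpret mv_algebra A by fact
  note [simp] = mv_image_simps[OF \<open>inj j\<close>]
  show ?thesis
  proof (unfold_locales, goal_cases)
    case (5 x y)
    then show ?case by (auto simp: plus_comm)
  next
    case (9 x y)
    then show ?case by (auto dest: lukasiewicz)
  qed (auto simp: plus_closed neg_closed zero_closed plus_assoc plus_zero neg_neg plus_neg_zero)
qed

section \<open>Fully faithful and essentially surjective functors\<close>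

lemma is_isoI:
  assumes "f \<in> Hom C X Y" "g \<in> Hom C Y X" "Comp C X Y X g f = Ident C X" "Comp C Y X Y f g = Ident C Y"
  shows "is_iso C X Y f"
  using assms by (auto simp: is_iso_def)

lemma category_imp_cat_functor_id:
  assumes "category C"
  shows "cat_functor C C id_functor"
proof -
  interpret category C by fact
  show ?thesis by unfold_locales (auto simp: id_functor_def)
qed

lemma cat_functor_comp_functor:
  assumes "cat_functor C D F" "cat_functor D E G"
  shows "cat_functor C E (comp_functor G F)"
proof -
  interpret F: cat_functor C D F by fact
  interpret G: cat_functor D E G by fact
  show ?thesis
    by unfold_locales
      (auto simp: comp_functor_def F.on_Ob_Ob F.on_Hom_Hom F.on_Hom_Ident F.on_Hom_Comp
        G.on_Ob_Ob G.on_Hom_Hom G.on_Hom_Ident G.on_Hom_Comp)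
qed

text \<open>The quasi-inverse chooses for each \<open>Y\<close> an object \<open>S Y\<close> with an
  isomorphism \<open>e Y\<close> from its image to \<open>Y\<close>, and lifts the conjugates of
  morphisms by these isomorphisms.\<close>

lemma equivalence_of_categoriesI:
  assumes F: "cat_functor C D F"
    and full: "\<And>X Y g. \<lbrakk>X \<in> Ob C; Y \<in> Ob C; g \<in> Hom D (on_Ob F X) (on_Ob F Y)\<rbrakk>
      \<Longrightarrow> \<exists>f\<in>Hom C X Y. on_Hom F X Y f = g"
    and faithful: "\<And>X Y f f'. \<lbrakk>X \<in> Ob C; Y \<in> Ob C; f \<in> Hom C X Y; f' \<in> Hom C X Y;
      on_Hom F X Y f = on_Hom F X Y f'\<rbrakk> \<Longrightarrow> f = f'"
    and ess_surj: "\<And>Y. Y \<in> Ob D \<Longrightarrow> \<exists>X\<in>Ob C. \<exists>e. is_iso D (on_Ob F X) Y e"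
  shows "equivalence_of_categories C D F"
proof -
  interpret F: cat_functor C D F by fact
  have "\<exists>X e d. X \<in> Ob C \<and> e \<in> Hom D (on_Ob F X) Y \<and> d \<in> Hom D Y (on_Ob F X) \<and>
      Comp D (on_Ob F X) Y (on_Ob F X) d e = Ident D (on_Ob F X) \<and>
      Comp D Y (on_Ob F X) Y e d = Ident D Y" if "Y \<in> Ob D" for Y
    using ess_surj[OF that] by (fastforce simp: is_iso_def)
  then obtain S e d where "\<And>Y. Y \<in> Ob D \<Longrightarrow> S Y \<in> Ob C \<and> e Y \<in> Hom D (on_Ob F (S Y)) Y \<and>
      d Y \<in> Hom D Y (on_Ob F (S Y)) \<and>
      Comp D (on_Ob F (S Y)) Y (on_Ob F (S Y)) (d Y) (e Y) = Ident D (on_Ob F (S Y)) \<and>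
      Comp D Y (on_Ob F (S Y)) Y (e Y) (d Y) = Ident D Y"
    by metis
  then have S: "\<And>Y. Y \<in> Ob D \<Longrightarrow> S Y \<in> Ob C"
    and e: "\<And>Y. Y \<in> Ob D \<Longrightarrow> e Y \<in> Hom D (on_Ob F (S Y)) Y"
    and d: "\<And>Y. Y \<in> Ob D \<Longrightarrow> d Y \<in> Hom D Y (on_Ob F (S Y))"
    and de: "\<And>Y. Y \<in> Ob D \<Longrightarrow>
      Comp D (on_Ob F (S Y)) Y (on_Ob F (S Y)) (d Y) (e Y) = Ident D (on_Ob F (S Y))"
    and ed: "\<And>Y. Y \<in> Ob D \<Longrightarrow> Comp D Y (on_Ob F (S Y)) Y (e Y) (d Y) = Ident D Y"
    by auto
  \<comment> \<open>A lift along the full functor \<open>F\<close>. Faithfulness makes it unique, so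
    equations between lifts are checked after applying \<open>F\<close>.\<close>
  define L where "L X Y g = (SOME f. f \<in> Hom C X Y \<and> on_Hom F X Y f = g)" for X Y g
  have L: "L X Y g \<in> Hom C X Y \<and> on_Hom F X Y (L X Y g) = g"
    if "X \<in> Ob C" "Y \<in> Ob C" "g \<in> Hom D (on_Ob F X) (on_Ob F Y)" for X Y g
    unfolding L_def by (rule someI_ex) (use full[OF that] in blast)
  \<comment> \<open>The conjugate of \<open>g\<close> by the chosen isomorphisms; its lift is the
    action of the quasi-inverse on \<open>g\<close>.\<close>
  define K where "K Y Z g = Comp D (on_Ob F (S Y)) Z (on_Ob F (S Z)) (d Z)
      (Comp D (on_Ob F (S Y)) Y Z g (e Y))" for Y Z g
  define G where "G = \<lparr>on_Ob = S, on_Hom = (\<lambda>Y Z g. L (S Y) (S Z) (K Y Z g))\<rparr>"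
  note ob = S F.on_Ob_Ob
  note cl = ob e d F.cod.Comp_Hom F.cod.Ident_Hom F.on_Hom_Hom F.dom.Comp_Hom F.dom.Ident_Hom
  have K: "K Y Z g \<in> Hom D (on_Ob F (S Y)) (on_Ob F (S Z))"
    if "Y \<in> Ob D" "Z \<in> Ob D" "g \<in> Hom D Y Z" for Y Z g
    using that by (simp add: K_def cl)
  have intertwine: "Comp D (on_Ob F (S Y)) (on_Ob F (S Z)) Z (e Z) (K Y Z g)
      = Comp D (on_Ob F (S Y)) Y Z g (e Y)"
    if "Y \<in> Ob D" "Z \<in> Ob D" "g \<in> Hom D Y Z" for Y Z g
    using that by (simp add: K_def cl ed F.cod.Comp_assoc F.cod.Comp_Ident_left)
  \<comment> \<open>\<open>e Y\<close> is monic because \<open>d Y\<close> is a left inverse;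
    equations about \<open>K\<close> can therefore be tested after composing with
    \<open>e\<close>.\<close>
  have cancel: "a = b"
    if "X \<in> Ob D" "Y \<in> Ob D" and a: "a \<in> Hom D X (on_Ob F (S Y))" and b: "b \<in> Hom D X (on_Ob F (S Y))"
      and eq: "Comp D X (on_Ob F (S Y)) Y (e Y) a = Comp D X (on_Ob F (S Y)) Y (e Y) b" for X Y a b
  proof -
    have "Comp D X Y (on_Ob F (S Y)) (d Y) (Comp D X (on_Ob F (S Y)) Y (e Y) x) = x"
      if "x \<in> Hom D X (on_Ob F (S Y))" for x
      using \<open>X \<in> Ob D\<close> \<open>Y \<in> Ob D\<close> that by (simp add: cl de F.cod.Comp_assoc F.cod.Comp_Ident_left)
    from this[OF a] this[OF b] eq show ?thesis by metis
  qed
  have K_Ident: "K Y Y (Ident D Y) = Ident D (on_Ob F (S Y))" if "Y \<in> Ob D" for Y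
    by (rule cancel[of "on_Ob F (S Y)" Y])
      (use that in \<open>simp_all add: cl K intertwine F.cod.Comp_Ident_left F.cod.Comp_Ident_right\<close>)
  have K_Comp: "K X Z (Comp D X Y Z h g)
      = Comp D (on_Ob F (S X)) (on_Ob F (S Y)) (on_Ob F (S Z)) (K Y Z h) (K X Y g)"
    if "X \<in> Ob D" "Y \<in> Ob D" "Z \<in> Ob D" "g \<in> Hom D X Y" "h \<in> Hom D Y Z" for X Y Z g h
  proof (rule cancel[of "on_Ob F (S X)" Z])
    let ?X = "on_Ob F (S X)" and ?Y = "on_Ob F (S Y)" and ?Z = "on_Ob F (S Z)"
    have "Comp D ?X ?Z Z (e Z) (Comp D ?X ?Y ?Z (K Y Z h) (K X Y g))
        = Comp D ?X ?Y Z (Comp D ?Y Y Z h (e Y)) (K X Y g)"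
      using that by (simp add: cl K intertwine F.cod.Comp_assoc)
    also have "\<dots> = Comp D ?X Y Z h (Comp D ?X X Y g (e X))"
      using that by (simp add: cl K intertwine F.cod.Comp_assoc[symmetric])
    also have "\<dots> = Comp D ?X ?Z Z (e Z) (K X Z (Comp D X Y Z h g))"
      using that by (simp add: cl intertwine F.cod.Comp_assoc)
    finally show "Comp D ?X ?Z Z (e Z) (K X Z (Comp D X Y Z h g))
        = Comp D ?X ?Z Z (e Z) (Comp D ?X ?Y ?Z (K Y Z h) (K X Y g))" by simp
  qed (use that in \<open>simp_all add: cl K\<close>)
  have G: "cat_functor D C G"
  proof
    fix Y assume "Y \<in> Ob D"
    then show "on_Hom G Y Y (Ident D Y) = Ident C (on_Ob G Y)"
      by (intro faithful[of "S Y" "S Y"]) (simp_all add: G_def cl L K_Ident F.on_Hom_Ident)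
  next
    fix X Y Z g h
    assume "X \<in> Ob D" "Y \<in> Ob D" "Z \<in> Ob D" "g \<in> Hom D X Y" "h \<in> Hom D Y Z"
    then show "on_Hom G X Z (Comp D X Y Z h g)
        = Comp C (on_Ob G X) (on_Ob G Y) (on_Ob G Z) (on_Hom G Y Z h) (on_Hom G X Y g)"
      by (intro faithful[of "S X" "S Z"]) (simp_all add: G_def cl L K K_Comp F.on_Hom_Comp)
  qed (auto simp: G_def cl L K)
  \<comment> \<open>The inverse of \<open>e\<close> at \<open>on_Ob F X\<close> has its source and
    target in the image of \<open>F\<close>, so it lifts.\<close>
  define \<eta> where "\<eta> X = L X (S (on_Ob F X)) (d (on_Ob F X))" for X
  have \<eta>: "natural_iso C C id_functor (comp_functor G F) \<eta>"
  proof (intro natural_iso.intro natural_iso_axioms.intro)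
    fix X assume X: "X \<in> Ob C"
    let ?Y = "S (on_Ob F X)"
    have "is_iso C X ?Y (\<eta> X)"
    proof (rule is_isoI[where g = "L ?Y X (e (on_Ob F X))"])
      show "Comp C X ?Y X (L ?Y X (e (on_Ob F X))) (\<eta> X) = Ident C X"
        using X by (intro faithful[of X X])
          (simp_all add: \<eta>_def cl L ed F.on_Hom_Comp F.on_Hom_Ident)
      show "Comp C ?Y X ?Y (\<eta> X) (L ?Y X (e (on_Ob F X))) = Ident C ?Y"
        using X by (intro faithful[of ?Y ?Y])
          (simp_all add: \<eta>_def cl L de F.on_Hom_Comp F.on_Hom_Ident)
    qed (use X in \<open>simp_all add: \<eta>_def cl L\<close>)
    then show "is_iso C (on_Ob id_functor X) (on_Ob (comp_functor G F) X) (\<eta> X)"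
      by (simp add: id_functor_def comp_functor_def G_def)
  next
    fix X Y f assume X: "X \<in> Ob C" and Y: "Y \<in> Ob C" and f: "f \<in> Hom C X Y"
    let ?X = "on_Ob F X" and ?Y = "on_Ob F Y" and ?f = "on_Hom F X Y f"
    let ?SX = "S ?X" and ?SY = "S ?Y"
    \<comment> \<open>Naturality of \<open>d\<close> on the image of \<open>F\<close>; faithfulness
      then transfers it to \<open>\<eta>\<close>.\<close>
    have "Comp D ?X (on_Ob F ?SX) (on_Ob F ?SY) (K ?X ?Y ?f) (d ?X)
        = Comp D ?X ?Y (on_Ob F ?SY) (d ?Y) ?f"
    proof (rule cancel[of ?X ?Y])
      have "Comp D ?X (on_Ob F ?SY) ?Y (e ?Y)
            (Comp D ?X (on_Ob F ?SX) (on_Ob F ?SY) (K ?X ?Y ?f) (d ?X))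
          = Comp D ?X (on_Ob F ?SX) ?Y (Comp D (on_Ob F ?SX) ?X ?Y ?f (e ?X)) (d ?X)"
        using X Y f by (simp add: cl K intertwine F.cod.Comp_assoc)
      also have "\<dots> = ?f"
        using X Y f by (simp add: cl ed F.cod.Comp_assoc[symmetric] F.cod.Comp_Ident_right)
      also have "\<dots> = Comp D ?X (on_Ob F ?SY) ?Y (e ?Y) (Comp D ?X ?Y (on_Ob F ?SY) (d ?Y) ?f)"
        using X Y f by (simp add: cl ed F.cod.Comp_assoc F.cod.Comp_Ident_left)
      finally show "Comp D ?X (on_Ob F ?SY) ?Y (e ?Y)
            (Comp D ?X (on_Ob F ?SX) (on_Ob F ?SY) (K ?X ?Y ?f) (d ?X))
          = Comp D ?X (on_Ob F ?SY) ?Y (e ?Y) (Comp D ?X ?Y (on_Ob F ?SY) (d ?Y) ?f)" .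
    qed (use X Y f in \<open>simp_all add: cl K\<close>)
    then have "Comp C X Y ?SY (\<eta> Y) f = Comp C X ?SX ?SY (L ?SX ?SY (K ?X ?Y ?f)) (\<eta> X)"
      using X Y f
      by (intro faithful[of X ?SY]) (simp_all add: \<eta>_def cl K L F.on_Hom_Comp)
    then show "Comp C (on_Ob id_functor X) (on_Ob id_functor Y) (on_Ob (comp_functor G F) Y) (\<eta> Y)
          (on_Hom id_functor X Y f)
        = Comp C (on_Ob id_functor X) (on_Ob (comp_functor G F) X) (on_Ob (comp_functor G F) Y)
          (on_Hom (comp_functor G F) X Y f) (\<eta> X)"
      by (simp add: id_functor_def comp_functor_def G_def)
  qed (intro category_imp_cat_functor_id cat_functor_comp_functor[OF F G] F.dom.category_axioms)+
  have \<epsilon>: "natural_iso D D (comp_functor F G) id_functor e"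
  proof (intro natural_iso.intro natural_iso_axioms.intro)
    fix Y assume "Y \<in> Ob D"
    then have "is_iso D (on_Ob F (S Y)) Y (e Y)" by (intro is_isoI[OF e d] de ed)
    then show "is_iso D (on_Ob (comp_functor F G) Y) (on_Ob id_functor Y) (e Y)"
      by (simp add: id_functor_def comp_functor_def G_def)
  next
    fix Y Z g assume "Y \<in> Ob D" "Z \<in> Ob D" "g \<in> Hom D Y Z"
    then show "Comp D (on_Ob (comp_functor F G) Y) (on_Ob (comp_functor F G) Z) (on_Ob id_functor Z)
          (e Z) (on_Hom (comp_functor F G) Y Z g)
        = Comp D (on_Ob (comp_functor F G) Y) (on_Ob id_functor Y) (on_Ob id_functor Z)
          (on_Hom id_functor Y Z g) (e Y)"
      by (simp add: id_functor_def comp_functor_def G_def S K L intertwine)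
  qed (intro category_imp_cat_functor_id cat_functor_comp_functor[OF G F] F.cod.category_axioms)+
  show ?thesis
    unfolding equivalence_of_categories_def using F G \<eta> \<epsilon> by blast
qed

section \<open>The kernel functor\<close>

lemma category_WHoops: "category WHoops"
proof (unfold_locales, goal_cases)
  case (1 H)
  then interpret wajsberg_hoop H by (simp add: WHoops_def)
  show ?case by (auto simp: WHoops_def hoop_hom_def imp_closed)
next
  case (2 H H' H'' f g)
  then interpret wajsberg_hoop H by (simp add: WHoops_def)
  show ?case using 2 by (auto simp: WHoops_def hoop_hom_def imp_closed compose_def Pi_def PiE_def)
next
  case (5 H H' H'' H''' f g h)
  then have "f \<in> carrier H \<rightarrow> carrier H'" by (auto simp: WHoops_def hoop_hom_def)
  then show ?case by (simp add: WHoops_def compose_assoc)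
qed (auto simp: WHoops_def hoop_hom_def PiE_def Id_compose compose_Id)

lemma category_MVAlg_over_two: "category MVAlg_over_two"
proof (unfold_locales, goal_cases)
  case (1 X)
  obtain A f where X: "X = (A, f)" by force
  interpret mv_algebra A using 1 by (simp add: MVAlg_over_two_def X)
  show ?case
    using 1 by (auto simp: MVAlg_over_two_def X mv_hom_def plus_closed neg_closed zero_closed PiE_def compose_Id)
next
  case (2 X Y Z \<phi> \<psi>)
  obtain A f B g C k where X: "X = (A, f)" "Y = (B, g)" "Z = (C, k)" by (metis surj_pair)
  interpret mv_algebra A using 2 by (simp add: MVAlg_over_two_def X)
  have \<phi>: "\<phi> \<in> carrier A \<rightarrow> carrier B" and eq: "compose (carrier B) k \<psi> = g" "compose (carrier A) g \<phi> = f"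
    using 2 by (auto simp: MVAlg_over_two_def X mv_hom_def)
  have "compose (carrier A) \<psi> \<phi> \<in> mv_hom A C"
    using 2 by (auto simp: MVAlg_over_two_def X mv_hom_def plus_closed neg_closed zero_closed
        compose_def Pi_def PiE_def)
  moreover have "compose (carrier A) k (compose (carrier A) \<psi> \<phi>) = f"
    using compose_assoc[OF \<phi>, of k \<psi>] eq by simp
  ultimately show ?case by (simp add: MVAlg_over_two_def X)
next
  case (5 W X Y Z f g h)
  then show ?case
    by (auto simp: MVAlg_over_two_def mv_hom_def PiE_def intro!: compose_assoc)
qed (auto simp: MVAlg_over_two_def mv_hom_def PiE_def Id_compose compose_Id)

lemma cat_functor_kernel_functor: "cat_functor MVAlg_over_two WHoops kernel_functor"
proof (intro cat_functor.intro cat_functor_axioms.intro category_MVAlg_over_two category_WHoops,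
    goal_cases)
  case (1 X)
  then show ?case
    by (auto simp: MVAlg_over_two_def WHoops_def kernel_functor_def wajsberg_hoop_mv_Ker)
next
  case (2 X Y \<phi>)
  obtain A f B g where X: "X = (A, f)" "Y = (B, g)" by force
  interpret A: mv_algebra A using 2 by (simp add: MVAlg_over_two_def X)
  have f: "f \<in> mv_hom A mv_two" and \<phi>: "\<phi> \<in> mv_hom A B" and "compose (carrier A) g \<phi> = f"
    using 2 by (auto simp: MVAlg_over_two_def X)
  \<comment> \<open>Commuting with the maps to the two-element algebra is what sends kernel elements
    to kernel elements.\<close>
  then have "g (\<phi> x) = f x" if "x \<in> carrier A" for x
    using that by (auto simp: compose_def)
  then show ?case
    using \<phi> mv_two_homD[OF f]
    by (auto simp: WHoops_def kernel_functor_def X hoop_hom_def carrier_mv_Ker mv_Ker_simps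
        mv_hom_def A.plus_closed A.neg_closed A.zero_closed)
next
  case (3 X)
  then show ?case
    by (auto simp: MVAlg_over_two_def WHoops_def kernel_functor_def carrier_mv_Ker fun_eq_iff)
next
  case (4 X Y Z \<phi> \<psi>)
  obtain A f B g C k where X: "X = (A, f)" "Y = (B, g)" "Z = (C, k)" by (metis surj_pair)
  have "\<phi> \<in> carrier A \<rightarrow> carrier B" and "compose (carrier A) g \<phi> = f"
    using 4 by (auto simp: MVAlg_over_two_def X mv_hom_def)
  then have "\<phi> x \<in> carrier B" "g (\<phi> x) = f x" if "x \<in> carrier A" for x
    using that by (auto simp: compose_def)
  then show ?case
    by (auto simp: MVAlg_over_two_def WHoops_def kernel_functor_def carrier_mv_Ker X
        compose_def fun_eq_iff)
qed

text \<open>The sign component maps the copied closure of \<open>H\<close> to the two-element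
  algebra. Its kernel is the copy of the positive elements, and forgetting the sign identifies this
  with \<open>H\<close>.\<close>

lemma kernel_functor_ess_surj:
  fixes H :: "'a hoop" and j :: "'a \<times> bool \<Rightarrow> 'a"
  assumes H: "wajsberg_hoop H" and j: "inj j"
  defines "A \<equiv> mv_image j (mv_closure H)"
  defines "f \<equiv> \<lambda>x\<in>carrier A. snd (inv_into UNIV j x)"
  shows "(A, f) \<in> Ob MVAlg_over_two"
    and "is_iso WHoops (mv_Ker (A, f)) H (\<lambda>x\<in>carrier (mv_Ker (A, f)). fst (inv_into UNIV j x))"
proof -
  interpret wajsberg_hoop H by fact
  note [simp] = mv_image_simps[OF j] mv_closure_simps inv_into_f_f[OF j] inj_eq[OF j]
  have "f \<in> mv_hom A mv_two"
    by (auto simp: mv_hom_def A_def f_def mv_two_def imp_closed hoop_plus_closed image_iff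
        mv_closure_def)
  then show "(A, f) \<in> Ob MVAlg_over_two"
    using mv_algebra_mv_image[OF mv_algebra_mv_closure[OF H] j]
    by (simp add: MVAlg_over_two_def A_def)
  have carrier: "carrier (mv_Ker (A, f)) = (\<lambda>a. j (a, True)) ` carrier H"
    by (auto simp: carrier_mv_Ker A_def f_def)
  let ?K = "mv_Ker (A, f)"
  let ?p = "\<lambda>x\<in>carrier ?K. fst (inv_into UNIV j x)" and ?i = "\<lambda>a\<in>carrier H. j (a, True)"
  have ops: "j (a, True) \<otimes>\<^bsub>?K\<^esub> j (b, True) = j (a \<otimes>\<^bsub>H\<^esub> b, True)"
    "j (a, True) \<leadsto>\<^bsub>?K\<^esub> j (b, True) = j (a \<leadsto>\<^bsub>H\<^esub> b, True)"
    "\<one>\<^bsub>?K\<^esub> = j (\<one>\<^bsub>H\<^esub>, True)" for a b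
    by (simp_all add: mv_Ker_simps A_def)
  show "is_iso WHoops ?K H ?p"
  proof (rule is_isoI[where g = ?i])
    show "?p \<in> Hom WHoops ?K H"
      by (auto simp: WHoops_def hoop_hom_def carrier ops imp_closed)
    show "?i \<in> Hom WHoops H ?K"
      by (auto simp: WHoops_def hoop_hom_def carrier ops imp_closed)
    show "Comp WHoops ?K H ?K ?i ?p = Ident WHoops ?K"
      by (auto simp: WHoops_def carrier compose_def fun_eq_iff)
    show "Comp WHoops H ?K H ?p ?i = Ident WHoops H"
      by (auto simp: WHoops_def carrier compose_def fun_eq_iff)
  qed
qed

text \<open>An infinite type absorbs a two-element factor, so the universe has room for the closure
  of any of its hoops. The embedding of \<open>bool\<close> needed for the cardinal bound passes
  through \<open>nat\<close>.\<close>

lemma ex_inj_prod_bool: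
  assumes "infinite (UNIV :: 'a set)"
  shows "\<exists>j :: 'a \<times> bool \<Rightarrow> 'a. inj j"
proof -
  obtain i :: "nat \<Rightarrow> 'a" where "inj i" using infinite_countable_subset[OF assms] by blast
  then have "inj (i \<circ> of_bool)" by (intro inj_compose) (auto simp: inj_def)
  then have "(card_of (UNIV :: bool set), card_of (UNIV :: 'a set)) \<in> ordLeq"
    unfolding card_of_ordLeq[symmetric] by blast
  then have "(card_of (UNIV \<times> UNIV :: ('a \<times> bool) set), card_of (UNIV :: 'a set)) \<in> ordLeq"
    using card_of_Times_infinite[OF assms, of "UNIV :: bool set"] ordIso_iff_ordLeq by blast
  then show ?thesis unfolding card_of_ordLeq[symmetric] UNIV_Times_UNIV by blast
qed

theorem corollary4p6:
  assumes "infinite (UNIV :: 'a set)"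
  shows "equivalence_of_categories
    (MVAlg_over_two :: ('a mv_algebra \<times> ('a \<Rightarrow> bool), 'a \<Rightarrow> 'a) cat)
    (WHoops :: ('a hoop, 'a \<Rightarrow> 'a) cat)
    kernel_functor"
proof (rule equivalence_of_categoriesI[OF cat_functor_kernel_functor])
  fix X Y :: "'a mv_algebra \<times> ('a \<Rightarrow> bool)" and h :: "'a \<Rightarrow> 'a"
  obtain A f B g where X: "X = (A, f)" "Y = (B, g)" by force
  assume "X \<in> Ob MVAlg_over_two" "Y \<in> Ob MVAlg_over_two"
    and "h \<in> Hom WHoops (on_Ob kernel_functor X) (on_Ob kernel_functor Y)"
  then have "mv_algebra A" "mv_algebra B" "f \<in> mv_hom A mv_two" "g \<in> mv_hom B mv_two"
    and "h \<in> hoop_hom (mv_Ker (A, f)) (mv_Ker (B, g))"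
    by (auto simp: MVAlg_over_two_def WHoops_def kernel_functor_def X)
  note ext = hom_extension_hom[OF this] compose_hom_extension[OF this] restrict_hom_extension[OF this]
  show "\<exists>\<phi>\<in>Hom MVAlg_over_two X Y. on_Hom kernel_functor X Y \<phi> = h"
    by (rule bexI[where x = "hom_extension (A, f) B h"])
      (use ext in \<open>simp_all add: MVAlg_over_two_def kernel_functor_def X\<close>)
next
  fix X Y :: "'a mv_algebra \<times> ('a \<Rightarrow> bool)" and \<phi> \<psi> :: "'a \<Rightarrow> 'a"
  assume "X \<in> Ob MVAlg_over_two" "Y \<in> Ob MVAlg_over_two"
    and "\<phi> \<in> Hom MVAlg_over_two X Y" "\<psi> \<in> Hom MVAlg_over_two X Y"
    and "on_Hom kernel_functor X Y \<phi> = on_Hom kernel_functor X Y \<psi>"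
  then show "\<phi> = \<psi>"
    by (cases X; cases Y) (auto simp: MVAlg_over_two_def kernel_functor_def intro: mv_hom_eqI)
next
  fix H :: "'a hoop"
  assume "H \<in> Ob WHoops"
  then have "wajsberg_hoop H" by (simp add: WHoops_def)
  moreover obtain j :: "'a \<times> bool \<Rightarrow> 'a" where "inj j"
    using ex_inj_prod_bool[OF assms] by blast
  ultimately show "\<exists>X\<in>Ob MVAlg_over_two. \<exists>e. is_iso WHoops (on_Ob kernel_functor X) H e"
    unfolding kernel_functor_def fctr.simps by (blast intro: kernel_functor_ess_surj)
qed

end
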